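(* Every four dimensional Tuba-Wenzl representation of $\mathcal{B}_3$ admits a standard extension to $\mathcal{LB}_3$. In particular, every irreducible four dimensional complex representation of $\mathcal{B}_3$ admits a standard extension to $\mathcal{LB}_3$.
   Context: $\mathcal{B}_3=\langle \sigma_1,\sigma_2 : \sigma_1\sigma_2\sigma_1=\sigma_2\sigma_1\sigma_2\rangle$ is the braid group. The three component loop braid group $\mathcal{LB}_3$ is the group generated by $\sigma_1,\sigma_2,s_1,s_2$ with relations $\sigma_1\sigma_2\sigma_1=\sigma_2\sigma_1\sigma_2$; $s_1s_2s_1=s_2s_1s_2$; $s_1^2=s_2^2=1$; $s_1s_2\sigma_1=\sigma_2s_1s_2$; $\sigma_1\sigma_2s_1=s_2\sigma_1\sigma_2$. An extension of a representation $\rho$ of $\mathcal{B}_3$ on $V$ to $\mathcal{LB}_3$ is a representation of $\mathcal{LB}_3$ on the same space with the same values on $\sigma_1,\sigma_2$; it is standard if $\rho(s_1s_2)=k\rho(\sigma_1\sigma_2)$ for some $k\in\mathbb{C}$. Four dimensional Tuba-Wenzl representations: let $\lambda_1,\lambda_2,\lambda_3,\lambda_4\in\mathbb{C}^\times$, choose $\gamma^2$ with $\gamma^4=\lambda_1\lambda_2\lambda_3\lambda_4$, and put $E=\lambda_1\lambda_4/\gamma^2$, $D=\lambda_2\lambda_3/\gamma^2$ (so $DE=1$). The representation is $\rho(\sigma_1)=A$, $\rho(\sigma_2)=B$ with $$A=\begin{pmatrix} \lambda_1 & (1+E+E^2)\lambda_2 & (1+E+E^2)\lambda_3 & \lambda_4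 \\ 0 & \lambda_2 & (1+E)\lambda_3 & \lambda_4 \\ 0 & 0 & \lambda_3 & \lambda_4 \\ 0 & 0 & 0 & \lambda_4 \end{pmatrix},$$ $$B=\begin{pmatrix} \lambda_4 & 0 & 0 & 0 \\ -\lambda_3 & \lambda_3 & 0 & 0 \\ {D}\lambda_2 & -(D+1)\lambda_2 & \lambda_2 & 0 \\ -D^3\lambda_1 & (D^3+D^2+D)\lambda_1 & -(D^2+D+1)\lambda_1 & \lambda_1 \end{pmatrix}.$$ By Tuba and Wenzl these define representations of $\mathcal{B}_3$ (not necessarily irreducible), and every irreducible four dimensional complex representation of $\mathcal{B}_3$ is equivalent to one of them. *)

theory Defs
  imports "HOL-Analysis.Analysis" "HOL-Algebra.Group"
begin

text \<open>Groups given by generators and relations. A letter \<open>(g, True)\<close> stands for the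
  generator \<open>g\<close> and \<open>(g, False)\<close> for its formal inverse.\<close>

type_synonym 'g gen_word = "('g \<times> bool) list"

inductive pres_eq :: "('g gen_word \<times> 'g gen_word) set \<Rightarrow> 'g gen_word \<Rightarrow> 'g gen_word \<Rightarrow> bool"
  for R where
  refl: "pres_eq R u u"
| sym: "pres_eq R u v \<Longrightarrow> pres_eq R v u"
| trans: "pres_eq R u v \<Longrightarrow> pres_eq R v w \<Longrightarrow> pres_eq R u w"
| cancel: "pres_eq R (u @ [(g, b), (g, \<not> b)] @ v) (u @ v)"
| rel: "(l, r) \<in> R \<Longrightarrow> pres_eq R (u @ l @ v) (u @ r @ v)"

definition word_class :: "('g gen_word \<times> 'g gen_word) set \<Rightarrow> 'g gen_word \<Rightarrow> 'g gen_word set" where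
  "word_class R u = {v. pres_eq R u v}"

definition presented_group :: "('g gen_word \<times> 'g gen_word) set \<Rightarrow> 'g gen_word set monoid" where
  "presented_group R =
    \<lparr>carrier = range (word_class R),
     monoid.mult = (\<lambda>X Y. \<Union>u\<in>X. \<Union>v\<in>Y. word_class R (u @ v)),
     one = word_class R []\<rparr>"

definition gen_class :: "('g gen_word \<times> 'g gen_word) set \<Rightarrow> 'g \<Rightarrow> 'g gen_word set" where
  "gen_class R g = word_class R [(g, True)]"

abbreviation pos_word :: "'g list \<Rightarrow> 'g gen_word" where
  "pos_word gs \<equiv> map (\<lambda>g. (g, True)) gs"


datatype braid_gen = Sigma1 | Sigma2

definition braid_rels :: "(braid_gen gen_word \<times> braid_gen gen_word) set" where
  "braid_rels = {(pos_word [Sigma1, Sigma2, Sigma1], pos_word [Sigma2, Sigma1, Sigma2])}"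

definition B3 :: "braid_gen gen_word set monoid" where
  "B3 = presented_group braid_rels"

datatype loop_gen = LSigma1 | LSigma2 | Perm1 | Perm2

definition loop_rels :: "(loop_gen gen_word \<times> loop_gen gen_word) set" where
  "loop_rels =
    {(pos_word [LSigma1, LSigma2, LSigma1], pos_word [LSigma2, LSigma1, LSigma2]),
     (pos_word [Perm1, Perm2, Perm1], pos_word [Perm2, Perm1, Perm2]),
     (pos_word [Perm1, Perm1], []),
     (pos_word [Perm2, Perm2], []),
     (pos_word [Perm1, Perm2, LSigma1], pos_word [LSigma2, Perm1, Perm2]),
     (pos_word [LSigma1, LSigma2, Perm1], pos_word [Perm2, LSigma1, LSigma2])}"

definition LB3 :: "loop_gen gen_word set monoid" where
  "LB3 = presented_group loop_rels"

abbreviation braid_elem :: "braid_gen \<Rightarrow> braid_gen gen_word set" where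
  "braid_elem \<equiv> gen_class braid_rels"

abbreviation loop_elem :: "loop_gen \<Rightarrow> loop_gen gen_word set" where
  "loop_elem \<equiv> gen_class loop_rels"


text \<open>The vector space \<open>V\<close> is the whole type \<open>'v\<close> with scalar multiplication \<open>sc\<close>.\<close>

definition GL_group :: "(complex \<Rightarrow> 'v \<Rightarrow> 'v) \<Rightarrow> ('v::ab_group_add \<Rightarrow> 'v) monoid" where
  "GL_group sc =
    \<lparr>carrier = {f. Vector_Spaces.linear sc sc f \<and> bij f},
     monoid.mult = (\<circ>), one = id\<rparr>"

definition representation ::
  "('g, 'm) monoid_scheme \<Rightarrow> (complex \<Rightarrow> 'v \<Rightarrow> 'v) \<Rightarrow> ('g \<Rightarrow> 'v::ab_group_add \<Rightarrow> 'v) \<Rightarrow> bool" where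
  "representation G sc \<rho> \<longleftrightarrow> vector_space sc \<and> \<rho> \<in> hom G (GL_group sc)"

definition irreducible_rep ::
  "('g, 'm) monoid_scheme \<Rightarrow> (complex \<Rightarrow> 'v \<Rightarrow> 'v) \<Rightarrow> ('g \<Rightarrow> 'v::ab_group_add \<Rightarrow> 'v) \<Rightarrow> bool" where
  "irreducible_rep G sc \<rho> \<longleftrightarrow>
     representation G sc \<rho> \<and> (UNIV :: 'v set) \<noteq> {0} \<and>
     (\<forall>W. module.subspace sc W \<and> (\<forall>g\<in>carrier G. \<rho> g ` W \<subseteq> W) \<longrightarrow> W = {0} \<or> W = UNIV)"

definition is_extension ::
  "(complex \<Rightarrow> 'v \<Rightarrow> 'v) \<Rightarrow> (braid_gen gen_word set \<Rightarrow> 'v::ab_group_add \<Rightarrow> 'v)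
    \<Rightarrow> (loop_gen gen_word set \<Rightarrow> 'v \<Rightarrow> 'v) \<Rightarrow> bool" where
  "is_extension sc \<rho> \<rho>' \<longleftrightarrow>
     representation LB3 sc \<rho>' \<and>
     \<rho>' (loop_elem LSigma1) = \<rho> (braid_elem Sigma1) \<and> \<rho>' (loop_elem LSigma2) = \<rho> (braid_elem Sigma2)"

definition is_standard_extension ::
  "(complex \<Rightarrow> 'v \<Rightarrow> 'v) \<Rightarrow> (braid_gen gen_word set \<Rightarrow> 'v::ab_group_add \<Rightarrow> 'v)
    \<Rightarrow> (loop_gen gen_word set \<Rightarrow> 'v \<Rightarrow> 'v) \<Rightarrow> bool" where
  "is_standard_extension sc \<rho> \<rho>' \<longleftrightarrow>
     is_extension sc \<rho> \<rho>' \<and>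
     (\<exists>k. \<rho>' (loop_elem Perm1 \<otimes>\<^bsub>LB3\<^esub> loop_elem Perm2)
        = (\<lambda>v. sc k (\<rho> (braid_elem Sigma1 \<otimes>\<^bsub>B3\<^esub> braid_elem Sigma2) v)))"

definition admits_standard_extension ::
  "(complex \<Rightarrow> 'v \<Rightarrow> 'v) \<Rightarrow> (braid_gen gen_word set \<Rightarrow> 'v::ab_group_add \<Rightarrow> 'v) \<Rightarrow> bool" where
  "admits_standard_extension sc \<rho> \<longleftrightarrow> (\<exists>\<rho>'. is_standard_extension sc \<rho> \<rho>')"


text \<open>In the following the argument \<open>g2\<close> is the chosen square root \<open>\<gamma>\<^sup>2\<close> of
  \<open>l1 * l2 * l3 * l4\<close>.\<close>

definition TW_A :: "complex \<Rightarrow> complex \<Rightarrow> complex \<Rightarrow> complex \<Rightarrow> complex \<Rightarrow> complex^4^4" where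
  "TW_A l1 l2 l3 l4 g2 =
    (let E = l1 * l4 / g2 in
     vector [vector [l1, (1 + E + E^2) * l2, (1 + E + E^2) * l3, l4],
             vector [0, l2, (1 + E) * l3, l4],
             vector [0, 0, l3, l4],
             vector [0, 0, 0, l4]])"

definition TW_B :: "complex \<Rightarrow> complex \<Rightarrow> complex \<Rightarrow> complex \<Rightarrow> complex \<Rightarrow> complex^4^4" where
  "TW_B l1 l2 l3 l4 g2 =
    (let D = l2 * l3 / g2 in
     vector [vector [l4, 0, 0, 0],
             vector [- l3, l3, 0, 0],
             vector [D * l2, - (D + 1) * l2, l2, 0],
             vector [- (D^3) * l1, (D^3 + D^2 + D) * l1, - (D^2 + D + 1) * l1, l1]])"

text \<open>Only the values of \<open>\<rho>\<close> on the carrier of \<open>B3\<close> matter, and these are determined by the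
  two matrices. Existence of such a \<open>\<rho>\<close> is shown in \<open>Tuba_Wenzl_rep_exists\<close> below.\<close>

definition is_Tuba_Wenzl_rep ::
  "complex \<Rightarrow> complex \<Rightarrow> complex \<Rightarrow> complex \<Rightarrow> complex
    \<Rightarrow> (braid_gen gen_word set \<Rightarrow> complex^4 \<Rightarrow> complex^4) \<Rightarrow> bool" where
  "is_Tuba_Wenzl_rep l1 l2 l3 l4 g2 \<rho> \<longleftrightarrow>
     l1 \<noteq> 0 \<and> l2 \<noteq> 0 \<and> l3 \<noteq> 0 \<and> l4 \<noteq> 0 \<and> g2^2 = l1 * l2 * l3 * l4 \<and>
     representation B3 (*s) \<rho> \<and>
     \<rho> (braid_elem Sigma1) = (\<lambda>v. TW_A l1 l2 l3 l4 g2 *v v) \<and>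
     \<rho> (braid_elem Sigma2) = (\<lambda>v. TW_B l1 l2 l3 l4 g2 *v v)"


lemma pres_eq_append:
  assumes "pres_eq R u v"
  shows "pres_eq R (x @ u @ y) (x @ v @ y)"
  using assms
proof induction
  case (cancel u g b v)
  show ?case using pres_eq.cancel[of R "x @ u" g b "v @ y"] by simp
next
  case (rel l r u v)
  then show ?case using pres_eq.rel[of l r R "x @ u" "v @ y"] by simp
qed (blast intro: pres_eq.intros)+

lemma pres_eq_append2:
  assumes "pres_eq R u u'" "pres_eq R v v'"
  shows "pres_eq R (u @ v) (u' @ v')"
proof (rule pres_eq.trans)
  show "pres_eq R (u @ v) (u' @ v)"
    using pres_eq_append[OF assms(1), of "[]" v] by simp
  show "pres_eq R (u' @ v) (u' @ v')"
    using pres_eq_append[OF assms(2), of u' "[]"] by simp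
qed

lemma word_class_eq_iff: "word_class R u = word_class R v \<longleftrightarrow> pres_eq R u v"
  unfolding word_class_def by (blast intro: pres_eq.intros)

lemma word_class_mult:
  "word_class R u \<otimes>\<^bsub>presented_group R\<^esub> word_class R v = word_class R (u @ v)"
proof -
  have "word_class R (u' @ v') = word_class R (u @ v)"
    if "u' \<in> word_class R u" "v' \<in> word_class R v" for u' v'
    unfolding word_class_eq_iff
    by (rule pres_eq.sym, rule pres_eq_append2) (use that in \<open>simp_all add: word_class_def\<close>)
  then have "(\<Union>u'\<in>word_class R u. \<Union>v'\<in>word_class R v. word_class R (u' @ v'))
      = (\<Union>u'\<in>word_class R u. \<Union>v'\<in>word_class R v. word_class R (u @ v))"
    by (intro SUP_cong) simp_all
  moreover have "word_class R u \<noteq> {}" "word_class R v \<noteq> {}"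
    using pres_eq.refl by (auto simp: word_class_def)
  ultimately show ?thesis
    by (simp add: presented_group_def)
qed

lemma pres_eq_inverse:
  "pres_eq R (rev (map (\<lambda>(g, b). (g, \<not> b)) u) @ u) []"
proof (induction u)
  case (Cons x u)
  obtain g b where x: "x = (g, b)" by force
  have "pres_eq R (rev (map (\<lambda>(g, b). (g, \<not> b)) u) @ [(g, \<not> b), (g, \<not> \<not> b)] @ u)
          (rev (map (\<lambda>(g, b). (g, \<not> b)) u) @ u)"
    by (rule pres_eq.cancel)
  with Cons show ?case by (auto simp: x intro: pres_eq.trans)
qed (simp add: pres_eq.refl)

lemma group_presented_group: "group (presented_group R)"
proof (rule groupI)
  fix X assume "X \<in> carrier (presented_group R)"
  then obtain u where X: "X = word_class R u" by (auto simp: presented_group_def)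
  have "word_class R (rev (map (\<lambda>(g, b). (g, \<not> b)) u)) \<otimes>\<^bsub>presented_group R\<^esub> X
          = \<one>\<^bsub>presented_group R\<^esub>"
    unfolding X word_class_mult using pres_eq_inverse
    by (auto simp: presented_group_def word_class_eq_iff)
  then show "\<exists>Y\<in>carrier (presented_group R). Y \<otimes>\<^bsub>presented_group R\<^esub> X = \<one>\<^bsub>presented_group R\<^esub>"
    by (auto simp: presented_group_def)
  show "\<one>\<^bsub>presented_group R\<^esub> \<otimes>\<^bsub>presented_group R\<^esub> X = X"
    using word_class_mult[of R "[]" u] by (simp add: X presented_group_def)
next
  fix X Y assume "X \<in> carrier (presented_group R)" "Y \<in> carrier (presented_group R)"
  then obtain u v where X: "X = word_class R u" "Y = word_class R v"
    by (auto simp: presented_group_def)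
  show "X \<otimes>\<^bsub>presented_group R\<^esub> Y \<in> carrier (presented_group R)"
    unfolding X word_class_mult by (simp add: presented_group_def)
  fix Z assume "Z \<in> carrier (presented_group R)"
  then obtain w where Z: "Z = word_class R w"
    by (auto simp: presented_group_def)
  show "X \<otimes>\<^bsub>presented_group R\<^esub> Y \<otimes>\<^bsub>presented_group R\<^esub> Z
      = X \<otimes>\<^bsub>presented_group R\<^esub> (Y \<otimes>\<^bsub>presented_group R\<^esub> Z)"
    unfolding X Z word_class_mult by simp
qed (simp add: presented_group_def)

fun word_eval :: "('a, 'm) monoid_scheme \<Rightarrow> ('g \<Rightarrow> 'a) \<Rightarrow> 'g gen_word \<Rightarrow> 'a" where
  "word_eval G f [] = \<one>\<^bsub>G\<^esub>"
| "word_eval G f ((g, b) # w) = (if b then f g else inv\<^bsub>G\<^esub> (f g)) \<otimes>\<^bsub>G\<^esub> word_eval G f w"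

lemma (in group) word_eval_closed:
  assumes "\<And>g. f g \<in> carrier G"
  shows "word_eval G f w \<in> carrier G"
  by (induction w) (auto simp: assms)

lemma (in group) word_eval_append:
  assumes "\<And>g. f g \<in> carrier G"
  shows "word_eval G f (u @ v) = word_eval G f u \<otimes> word_eval G f v"
  by (induction u) (auto simp: assms word_eval_closed m_assoc)

lemma (in group) presented_group_hom_exists:
  assumes f: "\<And>g. f g \<in> carrier G"
    and rels: "\<And>l r. (l, r) \<in> R \<Longrightarrow> word_eval G f l = word_eval G f r"
  shows "\<exists>h\<in>hom (presented_group R) G. \<forall>g. h (gen_class R g) = f g"
proof -
  have resp: "word_eval G f u = word_eval G f v" if "pres_eq R u v" for u v
    using that
  proof induction
    case (cancel u g b v)
    have "word_eval G f [(g, b), (g, \<not> b)] = \<one>" using f by auto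
    then show ?case
      by (simp only: word_eval_append[of f, OF f] l_one word_eval_closed[of f, OF f])
  next
    case (rel l r u v)
    then show ?case unfolding word_eval_append[of f, OF f] using rels by simp
  qed auto
  define h where "h = (\<lambda>X. word_eval G f (SOME w. w \<in> X))"
  have h: "h (word_class R u) = word_eval G f u" for u
  proof -
    have "(SOME w. w \<in> word_class R u) \<in> word_class R u"
      by (rule someI[of _ u]) (simp add: word_class_def pres_eq.refl)
    then show ?thesis unfolding h_def by (auto simp: word_class_def dest: resp)
  qed
  have "h \<in> hom (presented_group R) G"
  proof (rule homI)
    fix X assume "X \<in> carrier (presented_group R)"
    then show "h X \<in> carrier G"
      by (auto simp: presented_group_def h word_eval_closed[of f, OF f])
  next
    fix X Y assume "X \<in> carrier (presented_group R)" "Y \<in> carrier (presented_group R)"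
    then obtain u v where X: "X = word_class R u" "Y = word_class R v"
      by (auto simp: presented_group_def)
    show "h (X \<otimes>\<^bsub>presented_group R\<^esub> Y) = h X \<otimes> h Y"
      unfolding X word_class_mult h by (rule word_eval_append[of f, OF f])
  qed
  moreover have "\<forall>g. h (gen_class R g) = f g"
    using f by (simp add: gen_class_def h)
  ultimately show ?thesis by blast
qed

lemma group_GL_group:
  assumes "vector_space sc"
  shows "group (GL_group sc)"
proof -
  interpret vector_space sc by fact
  show ?thesis
  proof (rule groupI)
    fix f assume "f \<in> carrier (GL_group sc)"
    then have f: "Vector_Spaces.linear sc sc f" "bij f" by (simp_all add: GL_group_def)
    interpret f: Vector_Spaces.linear sc sc f by (rule f)
    let ?g = "inv_into UNIV f"
    have fg: "f (?g y) = y" for y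
      using f(2) by (simp add: bij_is_surj surj_f_inv_f)
    have gf: "?g (f x) = x" for x
      using f(2) by (simp add: bij_is_inj)
    have "Vector_Spaces.linear sc sc ?g"
    proof unfold_locales
      show "?g (x + y) = ?g x + ?g y" for x y
        using gf[of "?g x + ?g y"] by (simp only: f.add fg)
      show "?g (sc c x) = sc c (?g x)" for c x
        using gf[of "sc c (?g x)"] by (simp only: f.scale fg)
    qed
    moreover have "bij ?g" using f(2) by (rule bij_imp_bij_inv)
    moreover have "?g \<circ> f = id" by (simp add: fun_eq_iff gf)
    ultimately show "\<exists>g\<in>carrier (GL_group sc). g \<otimes>\<^bsub>GL_group sc\<^esub> f = \<one>\<^bsub>GL_group sc\<^esub>"
      by (intro bexI[of _ ?g]) (simp_all add: GL_group_def)
  next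
    fix f g assume "f \<in> carrier (GL_group sc)" "g \<in> carrier (GL_group sc)"
    then show "f \<otimes>\<^bsub>GL_group sc\<^esub> g \<in> carrier (GL_group sc)"
      by (auto simp: GL_group_def intro: bij_comp Vector_Spaces.linear_compose[of sc sc g sc f])
  next
    show "\<one>\<^bsub>GL_group sc\<^esub> \<in> carrier (GL_group sc)"
      by (simp add: GL_group_def linear_id)
  qed (simp_all add: GL_group_def o_assoc)
qed

lemma vector_4:
  "vector [a, b, c, d] $ (1::4) = a" "vector [a, b, c, d] $ (2::4) = b"
  "vector [a, b, c, d] $ (3::4) = c" "vector [a, b, c, d] $ (4::4) = d"
  unfolding vector_def by simp_all

lemma TW_braid_relation_aux:
  fixes l1 :: complex
  assumes h: "l1 * l4 = E * g" "l2 * l3 = D * g" "D * E = 1"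
  assumes A: "A = (vector [vector [l1, (1 + E + E^2) * l2, (1 + E + E^2) * l3, l4],
             vector [0, l2, (1 + E) * l3, l4],
             vector [0, 0, l3, l4],
             vector [0, 0, 0, l4]] :: complex^4^4)"
  and B: "B = (vector [vector [l4, 0, 0, 0],
             vector [- l3, l3, 0, 0],
             vector [D * l2, - (D + 1) * l2, l2, 0],
             vector [- (D^3) * l1, (D^3 + D^2 + D) * l1, - (D^2 + D + 1) * l1, l1]] :: complex^4^4)"
  shows "A ** B ** A = B ** A ** B"
proof -
  define P :: "complex^4^4" where
    "P = vector [vector [0, 0, 0, E * g],
                 vector [0, 0, - E * g, E * g],
                 vector [0, g, - (1 + E) * g, E * g],
                 vector [- (D^2) * g, (D^2 + D + 1) * g, - (D + 1 + E) * g, E * g]]"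
  note defs = A B P_def vec_eq_iff matrix_matrix_mult_def vec_lambda_beta
    forall_4 sum_4 vector_4 mult_zero_left mult_zero_right add_0_left add_0_right
  have AB: "A ** B = P"
    unfolding defs by (intro conjI; (insert h, algebra))
  have "P ** A = B ** P"
    unfolding defs by (intro conjI;
        (rule refl | (insert h(3), algebra) | (simp add: algebra_simps power2_eq_square power3_eq_cube; fail)))
  then show ?thesis
    by (simp add: AB flip: matrix_mul_assoc)
qed

lemma TW_braid_relation:
  assumes "l1 \<noteq> 0" "l2 \<noteq> 0" "l3 \<noteq> 0" "l4 \<noteq> 0" "g2^2 = l1 * l2 * l3 * l4"
  shows "TW_A l1 l2 l3 l4 g2 ** TW_B l1 l2 l3 l4 g2 ** TW_A l1 l2 l3 l4 g2
       = TW_B l1 l2 l3 l4 g2 ** TW_A l1 l2 l3 l4 g2 ** TW_B l1 l2 l3 l4 g2"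
proof -
  define E where "E = l1 * l4 / g2"
  define D where "D = l2 * l3 / g2"
  have "g2 \<noteq> 0" using assms by auto
  then have h12: "l1 * l4 = E * g2" "l2 * l3 = D * g2"
    by (simp_all add: E_def D_def)
  have "g2 * g2 = (D * g2) * (E * g2)"
    using assms(5) unfolding h12[symmetric] by (simp add: power2_eq_square mult_ac)
  then have "(D * E) * (g2 * g2) = 1 * (g2 * g2)"
    by (simp add: mult_ac)
  then have "D * E = 1"
    using \<open>g2 \<noteq> 0\<close> by (simp only: mult_cancel_right mult_eq_0_iff) simp
  note h = h12 this
  have A: "TW_A l1 l2 l3 l4 g2 = vector [vector [l1, (1 + E + E^2) * l2, (1 + E + E^2) * l3, l4],
             vector [0, l2, (1 + E) * l3, l4],
             vector [0, 0, l3, l4],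
             vector [0, 0, 0, l4]]"
    by (simp only: TW_A_def E_def Let_def)
  have B: "TW_B l1 l2 l3 l4 g2 = vector [vector [l4, 0, 0, 0],
             vector [- l3, l3, 0, 0],
             vector [D * l2, - (D + 1) * l2, l2, 0],
             vector [- (D^3) * l1, (D^3 + D^2 + D) * l1, - (D^2 + D + 1) * l1, l1]]"
    by (simp only: TW_B_def D_def Let_def)
  show ?thesis
    by (rule TW_braid_relation_aux[OF h A B])
qed

lemma TW_invertible:
  assumes "l1 \<noteq> 0" "l2 \<noteq> 0" "l3 \<noteq> 0" "l4 \<noteq> 0"
  shows "invertible (TW_A l1 l2 l3 l4 g2)" "invertible (TW_B l1 l2 l3 l4 g2)"
  unfolding invertible_left_inverse matrix_left_invertible_ker
  using assms
  by (auto simp: TW_A_def TW_B_def Let_def vec_eq_iff matrix_vector_mult_def forall_4 sum_4 vector_4)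

lemma matrix_in_GL_group:
  fixes M :: "complex^4^4"
  assumes "invertible M"
  shows "(\<lambda>v. M *v v) \<in> carrier (GL_group (*s))"
  using assms by (simp add: GL_group_def invertible_eq_bij matrix_vector_mul_linear_gen)

lemma Tuba_Wenzl_rep_exists:
  assumes "l1 \<noteq> 0" "l2 \<noteq> 0" "l3 \<noteq> 0" "l4 \<noteq> 0" "g2^2 = l1 * l2 * l3 * l4"
  shows "\<exists>\<rho>. is_Tuba_Wenzl_rep l1 l2 l3 l4 g2 \<rho>"
proof -
  let ?A = "TW_A l1 l2 l3 l4 g2" and ?B = "TW_B l1 l2 l3 l4 g2"
  let ?G = "GL_group (*s) :: (complex^4 \<Rightarrow> complex^4) monoid"
  define f where "f = (\<lambda>g v. (case g of Sigma1 \<Rightarrow> ?A | Sigma2 \<Rightarrow> ?B) *v v)"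
  interpret group ?G
    by (rule group_GL_group) (rule vec.vector_space_axioms)
  have f: "f g \<in> carrier ?G" for g
    using matrix_in_GL_group TW_invertible[OF assms(1-4)]
    by (auto simp: f_def split: braid_gen.split)
  have "f Sigma1 \<circ> (f Sigma2 \<circ> f Sigma1) = f Sigma2 \<circ> (f Sigma1 \<circ> f Sigma2)"
    using TW_braid_relation[OF assms]
    by (simp add: f_def fun_eq_iff matrix_vector_mul_assoc matrix_mul_assoc)
  then have "word_eval ?G f l = word_eval ?G f r" if "(l, r) \<in> braid_rels" for l r
    using that by (auto simp: braid_rels_def GL_group_def)
  then obtain h where "h \<in> hom B3 ?G" "\<And>g. h (braid_elem g) = f g"
    using presented_group_hom_exists[of f braid_rels] f unfolding B3_def by blast
  then show ?thesis
    using assms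
    by (intro exI[of _ h])
       (auto simp: is_Tuba_Wenzl_rep_def representation_def f_def vec.vector_space_axioms)
qed

end

theory Submission
  imports Defs "HOL-Computational_Algebra.Fundamental_Theorem_Algebra"
begin

text \<open>Let \<open>P\<close> be the image of \<open>\<sigma>\<^sub>1\<sigma>\<^sub>2\<close> and suppose that \<open>P\<^sup>3\<close> is a nonzero scalar. Scale \<open>P\<close> to \<open>T = k P\<close> with
  \<open>T\<^sup>3 = 1\<close>. If \<open>s\<close> is an involution with \<open>s T s = T\<^sup>-\<^sup>1\<close>, then \<open>s\<^sub>1 = s\<close> and \<open>s\<^sub>2 = s T\<close> satisfy all
  relations of the loop braid group and \<open>s\<^sub>1 s\<^sub>2 = k P\<close>. Such an \<open>s\<close> exists as soon as the eigenspaces of \<open>T\<close>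
  for the two primitive cube roots of unity have the same dimension, since it may then exchange
  them. In dimension four this can be arranged by the choice of \<open>k\<close> unless some eigenspace of \<open>P\<close>
  has dimension at least three. For the Tuba-Wenzl matrices this is excluded by looking at the first two rows of
  \<open>P\<close>; for irreducible representations it is excluded directly, without the Tuba-Wenzl classification.\<close>

section \<open>Cube roots of unity and eigenspaces over the complex numbers\<close>

text \<open>The roots of X^2 + X + 1 are the primitive cube roots of unity; the equation is solved
  for the square so that it can serve as a rewrite rule. The witness is exp(2 pi i / 3).\<close>

lemma obtain_primitive_cube_root:
  obtains w :: complex where "w * w = - 1 - w"
proof
  show "Complex (- 1 / 2) (sqrt 3 / 2) * Complex (- 1 / 2) (sqrt 3 / 2)
      = - 1 - Complex (- 1 / 2) (sqrt 3 / 2)"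
    by (simp add: complex_eq_iff)
qed

locale complex_fin_dim = finite_dimensional_vector_space sc Bs
  for sc :: "complex \<Rightarrow> 'v::ab_group_add \<Rightarrow> 'v" and Bs
begin

text \<open>For linear \<open>f\<close> and a \<open>c\<close> that is not an eigenvalue this is
  \<open>{0}\<close>, so multiplicity zero is covered by the same dimension counts.\<close>

definition eigenspace :: "('v \<Rightarrow> 'v) \<Rightarrow> complex \<Rightarrow> 'v set" where
  "eigenspace f c = {v. f v = sc c v}"

lemma subspace_eigenspace:
  assumes "Vector_Spaces.linear sc sc f"
  shows "subspace (eigenspace f c)"
proof -
  interpret f: Vector_Spaces.linear sc sc f by fact
  show ?thesis
    by (auto simp: subspace_def eigenspace_def f.add f.scale scale_right_distrib mult.commute)
qed

lemma eigenspace_disjoint: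
  assumes "a \<noteq> b"
  shows "eigenspace f a \<inter> eigenspace f b \<subseteq> {0}"
  using assms by (auto simp: eigenspace_def)

lemma dim_sums_disjoint:
  assumes "subspace S" "subspace T" "S \<inter> T \<subseteq> {0}"
  shows "dim {x + y |x y. x \<in> S \<and> y \<in> T} = dim S + dim T"
proof -
  have "dim (S \<inter> T) = 0"
    using assms(3) by (simp only: dim_eq_0)
  then show ?thesis
    using dim_sums_Int[OF assms(1,2)] by linarith
qed

text \<open>The polynomial X^2 - r^2 has the two distinct roots r and -r, so \<open>f\<close> is
  diagonalizable; the projections onto the two eigenspaces are (1 + f/r)/2 and (1 - f/r)/2.\<close>

lemma dim_eigenspaces_square_root:
  assumes lin: "Vector_Spaces.linear sc sc f"
    and sq: "\<And>v. f (f v) = sc (r * r) v" and "r \<noteq> 0"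
  shows "dim (eigenspace f r) + dim (eigenspace f (- r)) = dim (UNIV :: 'v set)"
proof -
  interpret f: Vector_Spaces.linear sc sc f by fact
  have "v \<in> {x + y |x y. x \<in> eigenspace f r \<and> y \<in> eigenspace f (- r)}" for v
  proof -
    let ?x = "sc (1 / 2) v + sc (1 / (2 * r)) (f v)" and ?y = "sc (1 / 2) v - sc (1 / (2 * r)) (f v)"
    have "v = ?x + ?y"
      by (simp add: scale_left_distrib[symmetric])
    moreover have "?x \<in> eigenspace f r" "?y \<in> eigenspace f (- r)"
      using \<open>r \<noteq> 0\<close> by (simp_all add: eigenspace_def f.add f.diff f.scale sq
          scale_right_distrib scale_right_diff_distrib)
    ultimately show ?thesis by blast
  qed
  then have "{x + y |x y. x \<in> eigenspace f r \<and> y \<in> eigenspace f (- r)} = UNIV" by blast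
  moreover have "r \<noteq> - r"
    using \<open>r \<noteq> 0\<close> by simp
  ultimately show ?thesis
    using dim_sums_disjoint[OF subspace_eigenspace[OF lin] subspace_eigenspace[OF lin]
      eigenspace_disjoint[of r "- r"]] by simp
qed

end

section \<open>Operators of order three and involutions that invert them\<close>

locale order_three_operator = complex_fin_dim sc Bs
  for sc :: "complex \<Rightarrow> 'v::ab_group_add \<Rightarrow> 'v" and Bs +
  fixes T :: "'v \<Rightarrow> 'v" and w :: complex
  assumes linear_T: "Vector_Spaces.linear sc sc T"
    and T3: "T (T (T v)) = v"
    and w2: "w * w = - 1 - w"
begin

interpretation T: Vector_Spaces.linear sc sc T by (rule linear_T)

abbreviation "E0 \<equiv> eigenspace T 1"
abbreviation "E1 \<equiv> eigenspace T w"
abbreviation "E2 \<equiv> eigenspace T (w * w)"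

text \<open>The spectral projections of \<open>T\<close>: averages of the powers T^i weighted by the
  inverse powers of the eigenvalue 1, \<open>w\<close> or \<open>w * w\<close>.\<close>

definition p0 where "p0 v = sc (1 / 3) (v + T v + T (T v))"
definition p1 where "p1 v = sc (1 / 3) (v + sc (w * w) (T v) + sc w (T (T v)))"
definition p2 where "p2 v = sc (1 / 3) (v + sc w (T v) + sc (w * w) (T (T v)))"

lemma w3: "w * (w * w) = 1" "w * w * (w * w) = w" "w * w * w = 1"
  using w2 by algebra+

lemma one_w_w2: "1 + w + w * w = 0"
  by (simp add: w2)

lemma linear_p: "Vector_Spaces.linear sc sc p0" "Vector_Spaces.linear sc sc p1"
    "Vector_Spaces.linear sc sc p2"
  by (unfold_locales, simp_all add: p0_def p1_def p2_def T.add T.scale scale_right_distrib ac_simps)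

lemma p_in: "p0 v \<in> E0" "p1 v \<in> E1" "p2 v \<in> E2"
  by (simp_all add: eigenspace_def p0_def p1_def p2_def T.add T.scale T3 scale_right_distrib ac_simps w3)

lemma p_sum: "p0 v + p1 v + p2 v = v"
proof -
  have "p0 v + p1 v + p2 v = sc (1 / 3) (sc 3 v + sc (1 + w + w * w) (T v) + sc (1 + w + w * w) (T (T v)))"
    unfolding p0_def p1_def p2_def
    by (simp add: scale_right_distrib[symmetric] scale_left_distrib del: distrib_left_numeral)
       (simp add: scale_left_distrib[of 1 1, simplified] scale_left_distrib[of 2 1, simplified] ac_simps)
  then show ?thesis by (simp add: one_w_w2)
qed

text \<open>Keeping \<open>z\<close> arbitrary lets one computation give all nine values of the
  projections on the three eigenspaces.\<close>

lemma p_eigenspace: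
  assumes "x \<in> eigenspace T z"
  shows "p0 x = sc ((1 + z + z * z) / 3) x"
    "p1 x = sc ((1 + w * w * z + w * (z * z)) / 3) x"
    "p2 x = sc ((1 + w * z + w * w * (z * z)) / 3) x"
proof -
  have "T x = sc z x" "T (T x) = sc (z * z) x"
    using assms by (simp_all add: eigenspace_def T.scale)
  then show "p0 x = sc ((1 + z + z * z) / 3) x"
    "p1 x = sc ((1 + w * w * z + w * (z * z)) / 3) x"
    "p2 x = sc ((1 + w * z + w * w * (z * z)) / 3) x"
    by (simp_all add: p0_def p1_def p2_def scale_left_distrib add_divide_distrib scale_right_distrib)
qed

lemma p_unique:
  assumes "a \<in> E0" "b \<in> E1" "c \<in> E2"
  shows "p0 (a + b + c) = a" "p1 (a + b + c) = b" "p2 (a + b + c) = c"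
proof -
  interpret p0: Vector_Spaces.linear sc sc p0 by (rule linear_p)
  interpret p1: Vector_Spaces.linear sc sc p1 by (rule linear_p)
  interpret p2: Vector_Spaces.linear sc sc p2 by (rule linear_p)
  have z: "1 + w * w + w = 0" "1 + w + w * w = 0"
    by (simp_all add: w2)
  note p = p_eigenspace[OF assms(1)] p_eigenspace[OF assms(2)] p_eigenspace[OF assms(3)]
  show "p0 (a + b + c) = a" "p1 (a + b + c) = b" "p2 (a + b + c) = c"
    by (simp_all add: p0.add p1.add p2.add p w3 z mult.assoc)
qed

lemma w_neq: "1 \<noteq> w" "1 \<noteq> w * w" "w \<noteq> w * w"
proof -
  show "1 \<noteq> w" using w2 by auto
  then show "w \<noteq> w * w" using w3(1) by auto
  show "1 \<noteq> w * w" using \<open>1 \<noteq> w\<close> w3(1) by auto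
qed

lemma dim_eigenspaces: "dim E0 + dim E1 + dim E2 = dim (UNIV :: 'v set)"
proof -
  note sub = subspace_eigenspace[OF linear_T]
  let ?S = "{x + y |x y. x \<in> E1 \<and> y \<in> E2}"
  have "E0 \<inter> ?S \<subseteq> {0}"
  proof
    fix v assume "v \<in> E0 \<inter> ?S"
    then obtain x y where v: "v \<in> E0" "v = x + y" "x \<in> E1" "y \<in> E2" by blast
    \<comment> \<open>\<open>p0\<close> is evaluated on \<open>v\<close> twice: it fixes
      \<open>v\<close> as an element of \<open>E0\<close> and kills \<open>v\<close> as a sum from
      \<open>E1\<close> and \<open>E2\<close>.\<close>
    have "0 \<in> E0" "0 \<in> E1" "0 \<in> E2"
      by (simp_all add: eigenspace_def)
    then show "v \<in> {0}"
      using p_unique(1)[OF v(1), of 0 0] p_unique(1)[of 0 x y] v by simp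
  qed
  then have "dim {x + y |x y. x \<in> E0 \<and> y \<in> ?S} = dim E0 + dim ?S"
    by (intro dim_sums_disjoint sub subspace_sums)
  moreover have "dim ?S = dim E1 + dim E2"
    by (intro dim_sums_disjoint sub eigenspace_disjoint w_neq)
  moreover have "v \<in> {x + y |x y. x \<in> E0 \<and> y \<in> ?S}" for v
  proof -
    have "v = p0 v + (p1 v + p2 v)" "p1 v + p2 v \<in> ?S"
      using p_in[of v] p_sum[of v] by (auto simp: add.assoc)
    then show ?thesis
      using p_in(1)[of v] by blast
  qed
  then have "{x + y |x y. x \<in> E0 \<and> y \<in> ?S} = UNIV" by blast
  ultimately show ?thesis by simp
qed

text \<open>The involution is the identity on \<open>E0\<close> and exchanges \<open>E1\<close> and
  \<open>E2\<close> by an isomorphism and its inverse. Since \<open>w\<close> and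
  \<open>w * w\<close> are inverse to each other, exchanging their eigenspaces turns
  \<open>T\<close> into its inverse.\<close>

lemma exists_inverting_involution:
  assumes "dim E1 = dim E2"
  obtains s where "Vector_Spaces.linear sc sc s" "\<And>v. s (s v) = v" "\<And>v. s (T (s (T v))) = v"
proof -
  interpret pair: finite_dimensional_vector_space_pair sc Bs sc Bs ..
  note sub = subspace_eigenspace[OF linear_T]
  obtain f where f: "Vector_Spaces.linear sc sc f" "f ` E1 = E2" "inj_on f E1"
    using pair.subspace_isomorphism[OF sub sub assms] by blast
  obtain g where g: "Vector_Spaces.linear sc sc g" "\<And>v. v \<in> E1 \<Longrightarrow> g (f v) = v"
    using pair.linear_exists_left_inverse_on[OF f(1) sub f(3)] by blast
  \<comment> \<open>As \<open>f\<close> maps \<open>E1\<close> onto \<open>E2\<close>, the left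
    inverse \<open>g\<close> on \<open>E1\<close> is a two-sided inverse between these
    spaces.\<close>
  have fg: "g v \<in> E1" "f (g v) = v" if "v \<in> E2" for v
  proof -
    obtain u where "u \<in> E1" "v = f u" using f(2) \<open>v \<in> E2\<close> by blast
    then show "g v \<in> E1" "f (g v) = v" by (simp_all add: g(2))
  qed
  have f_in: "f v \<in> E2" if "v \<in> E1" for v
    using f(2) that by blast
  interpret f: Vector_Spaces.linear sc sc f by (rule f(1))
  interpret g: Vector_Spaces.linear sc sc g by (rule g(1))
  interpret p0: Vector_Spaces.linear sc sc p0 by (rule linear_p)
  interpret p1: Vector_Spaces.linear sc sc p1 by (rule linear_p)
  interpret p2: Vector_Spaces.linear sc sc p2 by (rule linear_p)
  define s where "s v = p0 v + g (p2 v) + f (p1 v)" for v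
  have lin: "Vector_Spaces.linear sc sc s"
    by unfold_locales (simp_all add: s_def p0.add p1.add p2.add f.add g.add
        p0.scale p1.scale p2.scale f.scale g.scale scale_right_distrib)
  interpret s: Vector_Spaces.linear sc sc s by (rule lin)
  have s_parts: "s (a + b + c) = a + g c + f b" if "a \<in> E0" "b \<in> E1" "c \<in> E2" for a b c
    using p_unique[OF that] by (simp add: s_def)
  have T_parts: "T (a + b + c) = a + sc w b + sc (w * w) c" if "a \<in> E0" "b \<in> E1" "c \<in> E2" for a b c
    using that by (simp add: T.add eigenspace_def)
  note mem = fg f_in subspace_scale[OF sub]
  have "s (s (a + b + c)) = a + b + c" if "a \<in> E0" "b \<in> E1" "c \<in> E2" for a b c
    using that by (simp add: s_parts mem g)
  from this[OF p_in] have ss: "s (s v) = v" for v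
    by (metis p_sum)
  have "s (T (s (T (a + b + c)))) = a + b + c" if "a \<in> E0" "b \<in> E1" "c \<in> E2" for a b c
    using that by (simp add: T_parts s_parts mem g f.scale g.scale mult.assoc w3)
  from this[OF p_in] have "s (T (s (T v))) = v" for v
    by (metis p_sum)
  with lin ss show ?thesis by (rule that)
qed

end

section \<open>Rescaling to order three, and existence of eigenvectors\<close>

context complex_fin_dim
begin

lemma eigenspace_scaled:
  assumes "k \<noteq> 0"
  shows "eigenspace (\<lambda>v. sc k (f v)) (k * c) = eigenspace f c"
  using assms by (auto simp: eigenspace_def simp flip: scale_scale)

text \<open>Three multiplicities at most two that add up to four must contain a repeated value,
  so some rescaling of \<open>P\<close> has equally large eigenspaces for the two primitive cube roots of unity.\<close>

lemma exists_scaled_inverting_involution: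
  assumes dim4: "dim (UNIV :: 'v set) = 4"
    and linear_P: "Vector_Spaces.linear sc sc P"
    and P3: "\<And>v. P (P (P v)) = sc c v" and "c \<noteq> 0"
    and small: "\<And>z. dim (eigenspace P z) \<le> 2"
  obtains k s where "k \<noteq> 0" "\<And>v. sc (k * k * k) (P (P (P v))) = v"
    "Vector_Spaces.linear sc sc s" "\<And>v. s (s v) = v"
    "\<And>v. s (sc k (P (s (sc k (P v))))) = v"
proof -
  interpret P: Vector_Spaces.linear sc sc P by (rule linear_P)
  obtain w :: complex where w2: "w * w = - 1 - w" by (rule obtain_primitive_cube_root)
  have w3: "w * (w * w) = 1" using w2 by algebra
  then have w3': "w * w * w = 1" "w * w * (w * w) = w" by algebra+
  then have "w \<noteq> 0" by auto
  \<comment> \<open>A cube root of 1/c, so that \<open>k\<close> times \<open>P\<close> has order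
    three.\<close>
  define k where "k = 1 / exp (Ln c / 3)"
  have "exp (Ln c / 3) ^ 3 = c"
    using \<open>c \<noteq> 0\<close> by (simp flip: exp_of_nat_mult)
  then have k3: "k * k * k * c = 1"
    using \<open>c \<noteq> 0\<close> by (simp add: k_def power3_eq_cube field_simps)
  then have "k \<noteq> 0" by auto
  have op: "order_three_operator sc Bs (\<lambda>v. sc m (P v)) w" if "m * m * m * c = 1" for m
  proof (unfold_locales)
    show "sc m (P (sc m (P (sc m (P v))))) = v" for v
      using that by (simp add: P.scale P3 mult.assoc)
  qed (simp_all add: P.add P.scale scale_right_distrib mult.commute w2)
  define d where "d m z = dim (eigenspace (\<lambda>v. sc m (P v)) z)" for m z
  have sum: "d k 1 + d k w + d k (w * w) = 4"
    using order_three_operator.dim_eigenspaces[OF op[OF k3]] dim4 by (simp add: d_def)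
  have small': "d k z \<le> 2" for z
    using small[of "z / k"] eigenspace_scaled[OF \<open>k \<noteq> 0\<close>, of P "z / k"] \<open>k \<noteq> 0\<close> by (simp add: d_def)
  \<comment> \<open>Rescaling the operator by \<open>a\<close> multiplies its eigenvalues by
    \<open>a\<close>; powers of \<open>w\<close> therefore permute the three multiplicities
    cyclically.\<close>
  have shift: "d (k * a) (a * z) = d k z" if "a \<noteq> 0" for a z
    using eigenspace_scaled[OF that, of "\<lambda>v. sc k (P v)" z] by (simp add: d_def mult.commute)
  \<comment> \<open>Pairwise distinct multiplicities would be 0, 1, 2 and add up to 3. Multiplying
    by \<open>w\<close> carries the pair 1, \<open>w\<close> to \<open>w\<close>,
    \<open>w * w\<close>; multiplying by \<open>w * w\<close> carries the pair 1,
    \<open>w * w\<close> to \<open>w * w\<close>, \<open>w\<close>.\<close>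
  have "\<exists>m. m * m * m * c = 1 \<and> d m w = d m (w * w)"
  proof -
    consider "d k w = d k (w * w)" | "d k 1 = d k w" | "d k 1 = d k (w * w)"
      using sum small'[of 1] small'[of w] small'[of "w * w"] by linarith
    then show ?thesis
    proof cases
      case 1
      then show ?thesis using k3 by blast
    next
      case 2
      have "(k * w) * (k * w) * (k * w) * c = 1"
        using k3 w3 by algebra
      moreover have "d (k * w) w = d (k * w) (w * w)"
        using shift[OF \<open>w \<noteq> 0\<close>, of 1] shift[OF \<open>w \<noteq> 0\<close>, of w] 2 by simp
      ultimately show ?thesis by blast
    next
      case 3
      have "(k * (w * w)) * (k * (w * w)) * (k * (w * w)) * c = 1"
        using k3 w3 by algebra
      moreover have "d (k * (w * w)) w = d (k * (w * w)) (w * w)"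
        using shift[of "w * w" 1] shift[of "w * w" "w * w"] \<open>w \<noteq> 0\<close> 3
        by (simp only: w3' mult_1_right no_zero_divisors not_False_eq_True)
      ultimately show ?thesis by blast
    qed
  qed
  then obtain m where m: "m * m * m * c = 1" "d m w = d m (w * w)" by blast
  then have "m \<noteq> 0" by auto
  obtain s where s: "Vector_Spaces.linear sc sc s" "\<And>v. s (s v) = v"
      "\<And>v. s (sc m (P (s (sc m (P v))))) = v"
    using order_three_operator.exists_inverting_involution[OF op[OF m(1)]] m(2)
    unfolding d_def by blast
  have "sc (m * m * m) (P (P (P v))) = v" for v
    using m(1) by (simp add: P3)
  from \<open>m \<noteq> 0\<close> this s show ?thesis by (rule that)
qed

text \<open>By dimension some nonzero polynomial in \<open>f\<close> annihilates a given nonzero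
  vector; splitting off linear factors one at a time must reach an eigenvector.\<close>

lemma exists_eigenvector:
  assumes nontrivial: "(UNIV :: 'v set) \<noteq> {0}" and lin: "Vector_Spaces.linear sc sc f"
  obtains c v where "v \<noteq> 0" "f v = sc c v"
proof -
  interpret f: Vector_Spaces.linear sc sc f by (rule lin)
  have lin_pow: "Vector_Spaces.linear sc sc (f ^^ n)" for n
  proof (induction n)
    case 0
    then show ?case by (simp only: funpow.simps linear_id)
  next
    case (Suc n)
    then show ?case
      using Vector_Spaces.linear_compose[OF Suc lin] by (simp only: funpow.simps)
  qed
  \<comment> \<open>This is p(f) applied to \<open>v\<close>; \<open>ev_n\<close> allows any
    summation bound from the degree upwards, so that sums for different polynomials can be
    compared.\<close>
  define ev where "ev p v = (\<Sum>i\<le>degree p. sc (coeff p i) ((f ^^ i) v))" for p v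
  have ev_n: "ev p v = (\<Sum>i\<le>n. sc (coeff p i) ((f ^^ i) v))" if "degree p \<le> n" for p n v
    unfolding ev_def using that
    by (intro sum.mono_neutral_left) (auto simp: coeff_eq_0)
  have ev_root: "ev ([:- a, 1:] * q) v = ev q (f v - sc a v)" for a q v
  proof -
    let ?n = "degree q"
    have deg: "degree ([:- a, 1:] * q) \<le> Suc ?n"
      using degree_mult_le[of "[:- a, 1:]" q] by simp
    have "ev ([:- a, 1:] * q) v
        = (\<Sum>i\<le>Suc ?n. sc (coeff (pCons 0 q) i) ((f ^^ i) v)) - (\<Sum>i\<le>Suc ?n. sc (a * coeff q i) ((f ^^ i) v))"
      unfolding ev_n[OF deg] by (simp add: scale_left_diff_distrib sum_subtractf algebra_simps del: sum.atMost_Suc)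
    also have "(\<Sum>i\<le>Suc ?n. sc (coeff (pCons 0 q) i) ((f ^^ i) v)) = (\<Sum>i\<le>?n. sc (coeff q i) ((f ^^ i) (f v)))"
      by (subst sum.atMost_Suc_shift) (simp add: funpow_swap1)
    also have "(\<Sum>i\<le>Suc ?n. sc (a * coeff q i) ((f ^^ i) v)) = (\<Sum>i\<le>?n. sc (a * coeff q i) ((f ^^ i) v))"
      by (simp add: coeff_eq_0)
    also have "(\<Sum>i\<le>?n. sc (coeff q i) ((f ^^ i) (f v))) - (\<Sum>i\<le>?n. sc (a * coeff q i) ((f ^^ i) v))
        = ev q (f v - sc a v)"
    proof -
      have "(f ^^ i) (f v - sc a v) = (f ^^ i) (f v) - sc a ((f ^^ i) v)" for i
      proof -
        interpret fi: Vector_Spaces.linear sc sc "f ^^ i" by (rule lin_pow)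
        show ?thesis by (simp add: fi.diff fi.scale)
      qed
      then show ?thesis
        by (simp add: ev_def scale_right_diff_distrib sum_subtractf mult.commute)
    qed
    finally show ?thesis .
  qed
  \<comment> \<open>If X - a divides \<open>p\<close>, then either \<open>v\<close> is already an
    eigenvector for \<open>a\<close>, or f v - a v is a nonzero vector annihilated by the quotient,
    whose degree is smaller.\<close>
  have *: "\<exists>c v. v \<noteq> 0 \<and> f v = sc c v" if "p \<noteq> 0" "ev p v = 0" "v \<noteq> 0" for p v
    using that
  proof (induction "degree p" arbitrary: p v)
    case 0
    then obtain a where "p = [:a:]" "a \<noteq> 0" by (metis degree_eq_zeroE pCons_0_0)
    with 0 show ?case by (simp add: ev_def)
  next
    case (Suc n)
    then have "\<not> constant (poly p)" by (simp add: constant_degree)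
    then obtain a where "poly p a = 0"
      using fundamental_theorem_of_algebra by blast
    then obtain q where q: "p = [:- a, 1:] * q"
      by (metis dvdE poly_eq_0_iff_dvd)
    with Suc.prems have "q \<noteq> 0" by auto
    then have "n = degree q"
      using Suc.hyps(2) by (simp add: q degree_mult_eq del: mult_pCons_left)
    show ?case
    proof (cases "f v - sc a v = 0")
      case True
      then show ?thesis using Suc.prems by auto
    next
      case False
      then show ?thesis
        using Suc.hyps(1)[OF \<open>n = degree q\<close> \<open>q \<noteq> 0\<close>, of "f v - sc a v"] Suc.prems ev_root q by simp
    qed
  qed
  obtain v :: 'v where "v \<noteq> 0" using nontrivial by blast
  define n where "n = card Bs"
  \<comment> \<open>If the first n + 1 iterates of \<open>v\<close> are distinct, they are dependent
    because the dimension is \<open>n\<close>, and the coefficients of a linear relation give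
    \<open>p\<close>. If two of them coincide, X^j - X^i serves.\<close>
  have "\<exists>p. p \<noteq> 0 \<and> ev p v = 0"
  proof (cases "inj_on (\<lambda>i. (f ^^ i) v) {..n}")
    case True
    let ?S = "(\<lambda>i. (f ^^ i) v) ` {..n}"
    have "card ?S = Suc n" using True by (simp add: card_image)
    moreover have "dim ?S \<le> n"
      using dim_subset[of ?S UNIV] by (simp add: n_def)
    ultimately have "dependent ?S"
      by (intro dependent_biggerset_general) simp
    then obtain u where u: "\<exists>x\<in>?S. u x \<noteq> 0" "(\<Sum>x\<in>?S. sc (u x) x) = 0"
      unfolding dependent_finite[OF finite_imageI[OF finite_atMost]] by blast
    define p where "p = (\<Sum>i\<le>n. monom (u ((f ^^ i) v)) i)"
    have coeff: "coeff p i = (if i \<le> n then u ((f ^^ i) v) else 0)" for i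
      by (simp add: p_def coeff_sum if_distrib[of "\<lambda>x. x = _"])
    have "p \<noteq> 0"
      using u(1) coeff by (metis (no_types, lifting) atMost_iff coeff_0 imageE)
    moreover have "degree p \<le> n"
      by (intro degree_le) (simp add: coeff)
    then have "ev p v = (\<Sum>i\<le>n. sc (u ((f ^^ i) v)) ((f ^^ i) v))"
      by (simp add: ev_n coeff)
    then have "ev p v = 0"
      using u(2) by (simp add: sum.reindex[OF True])
    ultimately show ?thesis by blast
  next
    case False
    then obtain i j where ij: "i < j" "(f ^^ i) v = (f ^^ j) v"
      unfolding inj_on_def by (metis linorder_neqE_nat)
    let ?p = "monom 1 j - monom 1 i :: complex poly"
    have "coeff ?p j = 1" using ij(1) by simp
    then have "?p \<noteq> 0" by (metis coeff_0 zero_neq_one)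
    moreover have "degree ?p \<le> j"
      using ij(1) by (intro degree_le) auto
    then have "ev ?p v = 0"
      using ij by (simp add: ev_n scale_left_diff_distrib sum_subtractf if_distrib[of "\<lambda>c. sc c x" for x] cong: if_cong)
    ultimately show ?thesis by blast
  qed
  then show ?thesis
    using * \<open>v \<noteq> 0\<close> that by blast
qed

end

section \<open>Representations of presented groups, invariant subspaces and Schur's lemma\<close>

lemma word_class_carrier: "word_class R u \<in> carrier (presented_group R)"
  by (simp add: presented_group_def)

lemma gen_class_carrier: "gen_class R g \<in> carrier (presented_group R)"
  by (simp add: gen_class_def word_class_carrier)

lemma presented_rep_facts:
  assumes "representation (presented_group R) sc \<rho>"
  shows presented_rep_append: "\<rho> (word_class R (u @ v)) = \<rho> (word_class R u) \<circ> \<rho> (word_class R v)"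
    and presented_rep_Nil: "\<rho> (word_class R []) = id"
    and presented_rep_GL: "\<rho> (word_class R u) \<in> carrier (GL_group sc)"
proof -
  interpret group_hom "presented_group R" "GL_group sc" \<rho>
    using assms group_GL_group group_presented_group
    by (auto simp: group_hom_def group_hom_axioms_def representation_def)
  show "\<rho> (word_class R (u @ v)) = \<rho> (word_class R u) \<circ> \<rho> (word_class R v)"
    using hom_mult[OF word_class_carrier word_class_carrier, of u v]
    by (simp add: word_class_mult) (simp add: GL_group_def)
  show "\<rho> (word_class R []) = id"
    using hom_one by (simp add: presented_group_def GL_group_def)
  show "\<rho> (word_class R u) \<in> carrier (GL_group sc)"
    by (intro hom_closed word_class_carrier)
qed

lemma presented_rep_pos_word:
  assumes "representation (presented_group R) sc \<rho>"
  shows "\<rho> (word_class R (pos_word gs)) v = foldr (\<lambda>g. \<rho> (gen_class R g)) gs v"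
proof (induction gs)
  case Nil
  then show ?case by (simp add: presented_rep_Nil[OF assms])
next
  case (Cons g gs)
  then show ?case
    using presented_rep_append[OF assms, of "[(g, True)]" "pos_word gs"] by (simp add: gen_class_def)
qed

text \<open>The equivalence in the hypothesis, rather than an implication, also handles inverse
  letters: a generator maps the image of \<open>v\<close> under its inverse back to
  \<open>v\<close>.\<close>

lemma presented_rep_invariant:
  assumes rep: "representation (presented_group R) sc \<rho>"
    and inv: "\<And>g v. \<rho> (gen_class R g) v \<in> W \<longleftrightarrow> v \<in> W"
    and x: "x \<in> carrier (presented_group R)"
  shows "\<rho> x v \<in> W \<longleftrightarrow> v \<in> W"
proof -
  have letter: "\<rho> (word_class R [(g, b)]) v \<in> W \<longleftrightarrow> v \<in> W" for g b v
  proof (cases b)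
    case True
    then show ?thesis using inv by (simp add: gen_class_def)
  next
    case False
    have "word_class R [(g, True), (g, False)] = word_class R []"
      using pres_eq.cancel[of R "[]" g True "[]"] by (simp add: word_class_eq_iff)
    then have "\<rho> (gen_class R g) (\<rho> (word_class R [(g, False)]) v) = v"
      using presented_rep_append[OF rep, of "[(g, True)]" "[(g, False)]"]
      by (simp add: presented_rep_Nil[OF rep] gen_class_def fun_eq_iff)
    then show ?thesis
      using inv[of g "\<rho> (word_class R [(g, False)]) v"] False by simp
  qed
  have "\<rho> (word_class R u) v \<in> W \<longleftrightarrow> v \<in> W" for u
  proof (induction u)
    case Nil
    then show ?case by (simp add: presented_rep_Nil[OF rep])
  next
    case (Cons a u)
    then show ?case
      using presented_rep_append[OF rep, of "[a]" u] letter[of "fst a" "snd a"] by simp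
  qed
  then show ?thesis
    using x by (auto simp: presented_group_def)
qed

lemma irreducible_rep_invariant:
  assumes "irreducible_rep (presented_group R) sc \<rho>"
    and "module.subspace sc W" "\<And>g v. \<rho> (gen_class R g) v \<in> W \<longleftrightarrow> v \<in> W"
  shows "W = {0} \<or> W = UNIV"
  using assms presented_rep_invariant[of R sc \<rho> W] unfolding irreducible_rep_def by blast

text \<open>An eigenspace of \<open>f\<close> is invariant because \<open>f\<close> commutes with
  the generators, and it is nonzero for a suitable eigenvalue, hence everything.\<close>

lemma irreducible_rep_Schur:
  fixes sc :: "complex \<Rightarrow> 'v::ab_group_add \<Rightarrow> 'v"
  assumes irr: "irreducible_rep (presented_group R) sc \<rho>" and "complex_fin_dim sc Bs"
    and lin: "Vector_Spaces.linear sc sc f"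
    and comm: "\<And>g v. \<rho> (gen_class R g) (f v) = f (\<rho> (gen_class R g) v)"
  shows "\<exists>c. \<forall>v. f v = sc c v"
proof -
  interpret complex_fin_dim sc Bs by fact
  have rep: "Defs.representation (presented_group R) sc \<rho>" and nz: "(UNIV :: 'v set) \<noteq> {0}"
    using irr by (auto simp: irreducible_rep_def)
  obtain c v where v: "v \<noteq> 0" "f v = sc c v"
    by (rule exists_eigenvector[OF nz lin])
  have "\<rho> (gen_class R g) x \<in> eigenspace f c \<longleftrightarrow> x \<in> eigenspace f c" for g x
  proof -
    have GL: "Vector_Spaces.linear sc sc (\<rho> (gen_class R g))" "inj (\<rho> (gen_class R g))"
      using presented_rep_GL[OF rep, of "[(g, True)]"]
      by (auto simp: GL_group_def gen_class_def bij_is_inj)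
    interpret g: Vector_Spaces.linear sc sc "\<rho> (gen_class R g)" by (rule GL)
    show ?thesis
      by (simp only: eigenspace_def mem_Collect_eq comm[symmetric] g.scale[symmetric] inj_eq[OF GL(2)])
  qed
  from irreducible_rep_invariant[OF irr subspace_eigenspace[OF lin] this]
  have "eigenspace f c = UNIV"
    using v by (auto simp: eigenspace_def)
  then show ?thesis
    by (auto simp: eigenspace_def)
qed

section \<open>From an inverting involution to a standard extension\<close>

lemma braid_rep_relation:
  assumes "representation B3 sc \<rho>"
  shows "\<rho> (braid_elem Sigma1) (\<rho> (braid_elem Sigma2) (\<rho> (braid_elem Sigma1) v))
    = \<rho> (braid_elem Sigma2) (\<rho> (braid_elem Sigma1) (\<rho> (braid_elem Sigma2) v))"
proof -
  have "word_class braid_rels (pos_word [Sigma1, Sigma2, Sigma1])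
      = word_class braid_rels (pos_word [Sigma2, Sigma1, Sigma2])"
    unfolding word_class_eq_iff
    using pres_eq.rel[of "pos_word [Sigma1, Sigma2, Sigma1]" _ braid_rels "[]" "[]"]
    by (simp add: braid_rels_def)
  then show ?thesis
    using presented_rep_pos_word[OF assms[unfolded B3_def], of "[Sigma1, Sigma2, Sigma1]" v]
      presented_rep_pos_word[OF assms[unfolded B3_def], of "[Sigma2, Sigma1, Sigma2]" v]
    by simp
qed

lemma braid_rep_GL:
  assumes "representation B3 sc \<rho>"
  shows "Vector_Spaces.linear sc sc (\<rho> (braid_elem g))" "bij (\<rho> (braid_elem g))"
  using presented_rep_GL[OF assms[unfolded B3_def], of "[(g, True)]"]
  by (simp_all add: GL_group_def gen_class_def)

lemma involution_bij:
  assumes "\<And>v. f (f v) = v"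
  shows "bij f"
  by (rule o_bij[of f]) (simp_all add: fun_eq_iff assms)

text \<open>Write A, B for the images of the braid generators. The relations among
  \<open>s\<^sub>1 = s\<close> and \<open>s\<^sub>2 = s T\<close> follow from s T s = T^-1 = T^2.
  The first mixed relation reads T A = B T, which is k times ABA = BAB; the second reads A B s = s T
  A B, which is T s = s T^2 divided by k.\<close>

lemma admits_standard_extension_if_involution:
  fixes sc :: "complex \<Rightarrow> 'v::ab_group_add \<Rightarrow> 'v"
  assumes rep: "representation B3 sc \<rho>"
    and T_def: "\<And>v. T v = sc k (\<rho> (braid_elem Sigma1) (\<rho> (braid_elem Sigma2) v))"
    and T3: "\<And>v. T (T (T v)) = v" and "k \<noteq> 0"
    and s: "Vector_Spaces.linear sc sc s" "\<And>v. s (s v) = v" "\<And>v. s (T (s (T v))) = v"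
  shows "admits_standard_extension sc \<rho>"
proof -
  have vs: "vector_space sc" using rep by (simp add: representation_def)
  interpret vector_space sc by (rule vs)
  define A where "A = \<rho> (braid_elem Sigma1)"
  define B where "B = \<rho> (braid_elem Sigma2)"
  have T: "T v = sc k (A (B v))" for v by (simp add: T_def A_def B_def)
  have ABA: "A (B (A v)) = B (A (B v))" for v
    using braid_rep_relation[OF rep] by (simp add: A_def B_def)
  interpret A: Vector_Spaces.linear sc sc A unfolding A_def by (rule braid_rep_GL[OF rep])
  interpret B: Vector_Spaces.linear sc sc B unfolding B_def by (rule braid_rep_GL[OF rep])
  interpret s: Vector_Spaces.linear sc sc s by (rule s)
  have lin_T: "Vector_Spaces.linear sc sc T"
    by unfold_locales (simp_all add: T A.add B.add A.scale B.scale scale_right_distrib mult.commute)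
  have bij_T: "bij T"
    by (rule o_bij[of "\<lambda>v. T (T v)"]) (simp_all add: fun_eq_iff T3)
  have Ts: "T (s v) = s (T (T v))" for v
    using s(2)[of "T (s (T (T (T v))))"] s(3)[of "T (T v)"] by (simp add: T3)
  let ?G = "GL_group sc"
  interpret G: group ?G by (rule group_GL_group[OF vs])
  define f where "f g = (case g of LSigma1 \<Rightarrow> A | LSigma2 \<Rightarrow> B | Perm1 \<Rightarrow> s | Perm2 \<Rightarrow> s \<circ> T)" for g
  have f_in: "f g \<in> carrier ?G" for g
    using braid_rep_GL[OF rep] involution_bij[of s] s lin_T bij_T
    by (cases g) (auto simp: f_def GL_group_def A_def B_def
        intro: bij_comp Vector_Spaces.linear_compose)
  have ABs: "A (B (s v)) = s (T (A (B v)))" for v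
  proof -
    have "sc k (A (B (s v))) = sc k (s (T (A (B v))))"
      using Ts[of v] unfolding T by (simp add: A.scale B.scale s.scale)
    then show ?thesis using \<open>k \<noteq> 0\<close> by simp
  qed
  have "word_eval ?G f l = word_eval ?G f r" if "(l, r) \<in> loop_rels" for l r
    using that unfolding loop_rels_def
    by (auto simp: GL_group_def f_def fun_eq_iff ABA s Ts T3 ABs)
       (simp add: T ABA B.scale)
  then obtain h where h: "h \<in> hom LB3 ?G" "\<And>g. h (loop_elem g) = f g"
    using G.presented_group_hom_exists[of f loop_rels] f_in unfolding LB3_def by blast
  have "h (loop_elem Perm1 \<otimes>\<^bsub>LB3\<^esub> loop_elem Perm2) = h (loop_elem Perm1) \<circ> h (loop_elem Perm2)"
    using hom_mult[OF h(1)] gen_class_carrier[of loop_rels] by (simp add: LB3_def) (simp add: GL_group_def)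
  also have "\<dots> = T"
    by (simp add: h f_def fun_eq_iff s)
  also have "\<rho> (braid_elem Sigma1 \<otimes>\<^bsub>B3\<^esub> braid_elem Sigma2) = A \<circ> B"
    using rep hom_mult[of \<rho> B3 ?G] gen_class_carrier[of braid_rels]
    by (simp add: Defs.representation_def B3_def A_def B_def) (simp add: GL_group_def)
  then have "T = (\<lambda>v. sc k (\<rho> (braid_elem Sigma1 \<otimes>\<^bsub>B3\<^esub> braid_elem Sigma2) v))"
    by (simp add: T fun_eq_iff)
  finally show ?thesis
    using h vs unfolding admits_standard_extension_def is_standard_extension_def is_extension_def
      Defs.representation_def by (auto simp: f_def A_def B_def)
qed

section \<open>Irreducible four dimensional representations of the braid group\<close>

text \<open>The group is generated by \<open>P = \<sigma>\<^sub>1\<sigma>\<^sub>2\<close> and \<open>Q = \<sigma>\<^sub>1\<sigma>\<^sub>2\<sigma>\<^sub>1\<close>, and \<open>Q\<^sup>2 = P\<^sup>3\<close> is central.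
  A three-dimensional eigenspace of \<open>P\<close> would meet the larger eigenspace of \<open>Q\<close> in a
  common eigenvector.\<close>

lemma irreducible_braid_rep_eigenspaces:
  fixes sc :: "complex \<Rightarrow> 'v::ab_group_add \<Rightarrow> 'v"
  assumes irr: "irreducible_rep B3 sc \<rho>" and V: "complex_fin_dim sc Bs"
    and dim4: "vector_space.dim sc (UNIV :: 'v set) = 4"
    and P_def: "\<And>v. P v = \<rho> (braid_elem Sigma1) (\<rho> (braid_elem Sigma2) v)"
  obtains c where "c \<noteq> 0" "\<And>v. P (P (P v)) = sc c v"
    "\<And>z. vector_space.dim sc (complex_fin_dim.eigenspace sc P z) \<le> 2"
proof -
  interpret complex_fin_dim sc Bs by (rule V)
  have rep: "Defs.representation B3 sc \<rho>" and nz: "(UNIV :: 'v set) \<noteq> {0}"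
    using irr by (auto simp: irreducible_rep_def)
  define A where "A = \<rho> (braid_elem Sigma1)"
  define B where "B = \<rho> (braid_elem Sigma2)"
  have P: "P v = A (B v)" for v by (simp add: P_def A_def B_def)
  have ABA: "A (B (A v)) = B (A (B v))" for v
    using braid_rep_relation[OF rep] by (simp add: A_def B_def)
  have inj: "inj A" "inj B"
    unfolding A_def B_def by (intro bij_is_inj braid_rep_GL[OF rep])+
  interpret A: Vector_Spaces.linear sc sc A unfolding A_def by (rule braid_rep_GL[OF rep])
  interpret B: Vector_Spaces.linear sc sc B unfolding B_def by (rule braid_rep_GL[OF rep])
  have P0: "P v = 0 \<longleftrightarrow> v = 0" for v
    using inj_eq[OF inj(1), of "B v" 0] inj_eq[OF inj(2), of v 0] by (simp add: P)
  have gen: "\<rho> (gen_class braid_rels g) = (case g of Sigma1 \<Rightarrow> A | Sigma2 \<Rightarrow> B)" for g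
    by (cases g) (simp_all add: A_def B_def)
  have lin_P: "Vector_Spaces.linear sc sc P"
    by unfold_locales (simp_all add: P A.add B.add A.scale B.scale)
  interpret P: Vector_Spaces.linear sc sc P by (rule lin_P)
  define Q where "Q v = A (B (A v))" for v
  have lin_Q: "Vector_Spaces.linear sc sc Q"
    by unfold_locales (simp_all add: Q_def A.add B.add A.scale B.scale)
  \<comment> \<open>Regroup ABABAB as (ABA)(BAB).\<close>
  have P3: "P (P (P v)) = Q (Q v)" for v
    by (simp only: P Q_def ABA[of v])
  \<comment> \<open>Conjugation by \<open>Q\<close> exchanges \<open>A\<close> and \<open>B\<close>,
    so the square of \<open>Q\<close> commutes with both.\<close>
  have AQ: "A (Q v) = Q (B v)" and BQ: "B (Q v) = Q (A v)" for v
    by (simp_all only: Q_def ABA[of v]) (simp only: ABA[of v, symmetric] ABA[of "A v"])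
  have lin_P3: "Vector_Spaces.linear sc sc (\<lambda>v. P (P (P v)))"
    by unfold_locales (simp_all add: P.add P.scale)
  have central: "\<rho> (gen_class braid_rels g) (P (P (P v))) = P (P (P (\<rho> (gen_class braid_rels g) v)))" for g v
    unfolding P3 by (cases g) (simp_all add: gen AQ BQ)
  obtain c where "\<forall>v. P (P (P v)) = sc c v"
    using irreducible_rep_Schur[OF irr[unfolded B3_def] V lin_P3 central] by (rule exE)
  then have c: "P (P (P v)) = sc c v" for v
    by (rule spec)
  have "c \<noteq> 0"
  proof
    assume "c = 0"
    have "UNIV = {0 :: 'v}"
    proof (rule UNIV_eq_I)
      fix v :: 'v
      have "v = 0"
        using c[of v] \<open>c = 0\<close> by (simp add: P0)
      then show "v \<in> {0}" by simp
    qed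
    with nz show False by (rule notE)
  qed
  have Q2: "Q (Q v) = sc (csqrt c * csqrt c) v" for v
    using c[of v] P3[of v] by (simp flip: power2_eq_square)
  have "dim (eigenspace P z) \<le> 2" for z
  proof (rule ccontr)
    assume large: "\<not> dim (eigenspace P z) \<le> 2"
    \<comment> \<open>The two eigenspaces of \<open>Q\<close> fill the space, so one has dimension
      at least 2 and, as 3 + 2 > 4, meets the assumed large eigenspace of \<open>P\<close>
      nontrivially.\<close>
    have "dim (eigenspace Q (csqrt c)) + dim (eigenspace Q (- csqrt c)) = 4"
      using dim_eigenspaces_square_root[OF lin_Q Q2] \<open>c \<noteq> 0\<close> dim4 by simp
    then have "dim (eigenspace Q (csqrt c)) \<ge> 2 \<or> dim (eigenspace Q (- csqrt c)) \<ge> 2"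
      by linarith
    then obtain r where r: "dim (eigenspace Q r) \<ge> 2" "r * r = c"
    proof
      assume "dim (eigenspace Q (csqrt c)) \<ge> 2"
      then show ?thesis by (rule that) (simp flip: power2_eq_square)
    next
      assume "dim (eigenspace Q (- csqrt c)) \<ge> 2"
      then show ?thesis by (rule that) (simp flip: power2_eq_square)
    qed
    let ?I = "eigenspace P z \<inter> eigenspace Q r"
    have "dim {x + y |x y. x \<in> eigenspace P z \<and> y \<in> eigenspace Q r} \<le> 4"
      by (rule order.trans[OF dim_subset[OF subset_UNIV]]) (simp only: dim4 order.refl)
    then have "dim ?I \<noteq> 0"
      using dim_sums_Int[OF subspace_eigenspace[OF lin_P] subspace_eigenspace[OF lin_Q], of z r] large r(1)
      by linarith
    then obtain v where "v \<in> ?I" "v \<noteq> 0"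
      unfolding dim_eq_0 by blast
    then have v: "v \<noteq> 0" "P v = sc z v" "Q v = sc r v"
      by (simp_all add: eigenspace_def)
    have "z \<noteq> 0" "r \<noteq> 0"
      using v P0[of v] r \<open>c \<noteq> 0\<close> by auto
    \<comment> \<open>Since Q = P A, the common eigenvector of \<open>P\<close> and \<open>Q\<close>
      is one of \<open>A\<close>, and by P = A B also one of \<open>B\<close>. It spans an invariant
      line, which contradicts irreducibility in dimension four.\<close>
    have "P (A v) = P (sc (r / z) v)"
      using v \<open>z \<noteq> 0\<close> by (simp add: P.scale) (simp add: P Q_def)
    then have Av: "A v = sc (r / z) v"
      by (simp add: P inj_eq[OF inj(1)] inj_eq[OF inj(2)])
    have "A (B v) = A (sc (z * z / r) v)"
      using v \<open>r \<noteq> 0\<close> \<open>z \<noteq> 0\<close> by (simp add: A.scale Av P)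
    then have Bv: "B v = sc (z * z / r) v"
      by (simp add: inj_eq[OF inj(1)])
    have span_iff: "f x \<in> span {v} \<longleftrightarrow> x \<in> span {v}"
      if "Vector_Spaces.linear sc sc f" "inj f" "f v = sc m v" "m \<noteq> 0" for f m x
    proof
      interpret f: Vector_Spaces.linear sc sc f by (rule that)
      assume "f x \<in> span {v}"
      then obtain a where "f x = sc a v" by (auto simp: span_singleton)
      then have "f x = f (sc (a / m) v)" using that by (simp add: f.scale)
      then have "x = sc (a / m) v" by (simp add: inj_eq[OF that(2)])
      then show "x \<in> span {v}" by (auto simp: span_singleton)
    next
      interpret f: Vector_Spaces.linear sc sc f by (rule that)
      assume "x \<in> span {v}"
      then show "f x \<in> span {v}"
        using that(3) by (auto simp: span_singleton f.scale)
    qed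
    have "\<rho> (gen_class braid_rels g) x \<in> span {v} \<longleftrightarrow> x \<in> span {v}" for g x
      using span_iff[OF A.linear_axioms inj(1) Av] span_iff[OF B.linear_axioms inj(2) Bv]
        \<open>z \<noteq> 0\<close> \<open>r \<noteq> 0\<close> by (cases g) (simp_all add: gen)
    from irreducible_rep_invariant[OF irr[unfolded B3_def] subspace_span this]
    have "span {v} = UNIV"
      using span_base[of v "{v}"] \<open>v \<noteq> 0\<close> by auto
    then have "dim (UNIV :: 'v set) = dim {v}"
      by (metis dim_span)
    then show False
      using dim4 by (simp add: \<open>v \<noteq> 0\<close> del: dim_UNIV)
  qed
  with \<open>c \<noteq> 0\<close> c show ?thesis by (rule that)
qed

text \<open>The common last step of the Tuba-Wenzl and the irreducible case, which differ only in
  how the cube of \<open>P\<close> and its eigenspaces are controlled.\<close>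

lemma braid_rep_admits_standard_extension:
  fixes sc :: "complex \<Rightarrow> 'v::ab_group_add \<Rightarrow> 'v"
  assumes rep: "representation B3 sc \<rho>" and V: "complex_fin_dim sc Bs"
    and dim4: "vector_space.dim sc (UNIV :: 'v set) = 4"
    and P_def: "\<And>v. P v = \<rho> (braid_elem Sigma1) (\<rho> (braid_elem Sigma2) v)"
    and P3: "c \<noteq> 0" "\<And>v. P (P (P v)) = sc c v"
    and small: "\<And>z. vector_space.dim sc (complex_fin_dim.eigenspace sc P z) \<le> 2"
  shows "admits_standard_extension sc \<rho>"
proof -
  interpret complex_fin_dim sc Bs by (rule V)
  have "P = \<rho> (braid_elem Sigma1) \<circ> \<rho> (braid_elem Sigma2)"
    by (simp add: fun_eq_iff P_def)
  then have lin_P: "Vector_Spaces.linear sc sc P"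
    by (simp only: Vector_Spaces.linear_compose[OF braid_rep_GL(1)[OF rep] braid_rep_GL(1)[OF rep]])
  interpret P: Vector_Spaces.linear sc sc P by (rule lin_P)
  obtain k s where k: "k \<noteq> 0" "\<And>v. sc (k * k * k) (P (P (P v))) = v"
    and s: "Vector_Spaces.linear sc sc s" "\<And>v. s (s v) = v" "\<And>v. s (sc k (P (s (sc k (P v))))) = v"
    using exists_scaled_inverting_involution[OF dim4 lin_P P3(2,1) small] by metis
  define T where "T v = sc k (P v)" for v
  show ?thesis
  proof (rule admits_standard_extension_if_involution[OF rep _ _ k(1) s(1,2)])
    show "T v = sc k (\<rho> (braid_elem Sigma1) (\<rho> (braid_elem Sigma2) v))" for v
      by (simp add: T_def P_def)
    show "T (T (T v)) = v" for v
      using k(2)[of v] by (simp add: T_def P.scale mult.assoc)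
    show "s (T (s (T v))) = v" for v
      using s(3) by (simp add: T_def)
  qed
qed

section \<open>The Tuba-Wenzl matrices\<close>

text \<open>The parameters enter the product only through \<open>g\<close>, \<open>D\<close> and
  \<open>E\<close>, by l1 l4 = E g and l2 l3 = D g. The zeros in the first two rows are what bounds
  the eigenspaces later.\<close>

lemma TW_product:
  assumes "l1 \<noteq> 0" "l2 \<noteq> 0" "l3 \<noteq> 0" "l4 \<noteq> 0" "g^2 = l1 * l2 * l3 * l4"
  obtains D E where "D * E = 1" "TW_A l1 l2 l3 l4 g ** TW_B l1 l2 l3 l4 g =
    vector [vector [0, 0, 0, E * g],
            vector [0, 0, - E * g, E * g],
            vector [0, g, - (1 + E) * g, E * g],
            vector [- (D^2) * g, (D^2 + D + 1) * g, - (D + 1 + E) * g, E * g]]"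
proof -
  define E where "E = l1 * l4 / g"
  define D where "D = l2 * l3 / g"
  have "g \<noteq> 0" using assms by auto
  then have h: "l1 * l4 = E * g" "l2 * l3 = D * g"
    by (simp_all add: E_def D_def)
  have DE: "D * E = 1"
    using \<open>g \<noteq> 0\<close> assms(5) assms(1-4) by (simp add: D_def E_def field_simps power2_eq_square)
  have A: "TW_A l1 l2 l3 l4 g = vector [vector [l1, (1 + E + E^2) * l2, (1 + E + E^2) * l3, l4],
             vector [0, l2, (1 + E) * l3, l4],
             vector [0, 0, l3, l4],
             vector [0, 0, 0, l4]]"
    by (simp only: TW_A_def E_def Let_def)
  have B: "TW_B l1 l2 l3 l4 g = vector [vector [l4, 0, 0, 0],
             vector [- l3, l3, 0, 0],
             vector [D * l2, - (D + 1) * l2, l2, 0],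
             vector [- (D^3) * l1, (D^3 + D^2 + D) * l1, - (D^2 + D + 1) * l1, l1]]"
    by (simp only: TW_B_def D_def Let_def)
  have "TW_A l1 l2 l3 l4 g ** TW_B l1 l2 l3 l4 g =
    vector [vector [0, 0, 0, E * g],
            vector [0, 0, - E * g, E * g],
            vector [0, g, - (1 + E) * g, E * g],
            vector [- (D^2) * g, (D^2 + D + 1) * g, - (D + 1 + E) * g, E * g]]"
    unfolding A B
      vec_eq_iff matrix_matrix_mult_def vec_lambda_beta
      forall_4 sum_4 vector_4 mult_zero_left mult_zero_right add_0_left add_0_right
    by (intro conjI; (insert h DE, algebra))
  with DE show ?thesis by (rule that)
qed

lemma Tuba_Wenzl_admits_standard_extension:
  assumes "is_Tuba_Wenzl_rep l1 l2 l3 l4 g \<rho>"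
  shows "admits_standard_extension (*s) \<rho>"
proof -
  have l: "l1 \<noteq> 0" "l2 \<noteq> 0" "l3 \<noteq> 0" "l4 \<noteq> 0" "g^2 = l1 * l2 * l3 * l4"
    and rep: "Defs.representation B3 (*s) \<rho>"
    and \<rho>: "\<rho> (braid_elem Sigma1) = (\<lambda>v. TW_A l1 l2 l3 l4 g *v v)"
      "\<rho> (braid_elem Sigma2) = (\<lambda>v. TW_B l1 l2 l3 l4 g *v v)"
    using assms by (auto simp: is_Tuba_Wenzl_rep_def)
  have "g \<noteq> 0" using l by auto
  obtain D E where DE: "D * E = 1" and AB: "TW_A l1 l2 l3 l4 g ** TW_B l1 l2 l3 l4 g =
    vector [vector [0, 0, 0, E * g],
            vector [0, 0, - E * g, E * g],
            vector [0, g, - (1 + E) * g, E * g],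
            vector [- (D^2) * g, (D^2 + D + 1) * g, - (D + 1 + E) * g, E * g]]" (is "_ = ?M")
    by (rule TW_product[OF l])
  have V: "complex_fin_dim (*s) (cart_basis :: (complex^4) set)"
    by (simp add: complex_fin_dim_def vec.finite_dimensional_vector_space_axioms)
  interpret V: complex_fin_dim "(*s)" "cart_basis :: (complex^4) set" by (rule V)
  note coords = vec_eq_iff matrix_vector_mult_def vec_lambda_beta forall_4 sum_4 vector_4
    vector_smult_component
  \<comment> \<open>The cube is scalar by direct computation from D E = 1, so Schur's lemma is
    avoided and reducible cases are included.\<close>
  have cube: "?M *v (?M *v (?M *v v)) = (- (g * g * g)) *s v" for v
    unfolding coords by (intro conjI; (insert DE, algebra))
  have small: "vec.dim (V.eigenspace ((*v) ?M) z) \<le> 2" for z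
  proof (cases "z = 0")
    case True
    have "v = 0" if "?M *v v = 0 *s v" for v
      using cube[of v] that \<open>g \<noteq> 0\<close> by simp
    then have "V.eigenspace ((*v) ?M) z \<subseteq> {0}"
      using True by (auto simp: V.eigenspace_def)
    then show ?thesis
      by (metis vec.dim_eq_0 le0)
  next
    case False
    \<comment> \<open>The first two rows of the eigenvector equation determine the coordinates 1 and
      2 from 3 and 4. These are the vectors obtained for (0, 1) and (1, 0) in the last two
      coordinates.\<close>
    let ?a = "vector [E * g / z, E * g / z, 0, 1] :: complex^4"
    let ?b = "vector [0, - E * g / z, 1, 0] :: complex^4"
    have "V.eigenspace ((*v) ?M) z \<subseteq> vec.span {?a, ?b}"
    proof
      fix v assume "v \<in> V.eigenspace ((*v) ?M) z"
      then have "(?M *v v) $ 1 = (z *s v) $ 1" "(?M *v v) $ 2 = (z *s v) $ 2"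
        by (simp_all add: V.eigenspace_def)
      then have "v $ 1 = E * g * v $ 4 / z" "v $ 2 = (- E * g * v $ 3 + E * g * v $ 4) / z"
        using False by (simp_all add: matrix_vector_mult_def sum_4 vector_4 nonzero_eq_divide_eq mult.commute[of z])
      then have "v = (v $ 4) *s ?a + (v $ 3) *s ?b"
        by (simp add: vec_eq_iff forall_4 vector_4 add_divide_distrib diff_divide_distrib mult_ac)
      then show "v \<in> vec.span {?a, ?b}"
        by (metis vec.span_add vec.span_base vec.span_scale insertI1 insertI2)
    qed
    then have "vec.dim (V.eigenspace ((*v) ?M) z) \<le> card {?a, ?b}"
      by (intro vec.dim_le_card) simp_all
    also have "\<dots> \<le> 2" by (simp add: card_insert_if)
    finally show ?thesis .
  qed
  have c: "- (g * g * g) \<noteq> 0" using \<open>g \<noteq> 0\<close> by simp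
  have P: "?M *v v = \<rho> (braid_elem Sigma1) (\<rho> (braid_elem Sigma2) v)" for v
    by (simp add: \<rho> matrix_vector_mul_assoc AB)
  have dim4: "vec.dim (UNIV :: (complex^4) set) = 4"
    using vec_dim_card[where 'a=complex and 'n=4] by simp
  show ?thesis
    by (rule braid_rep_admits_standard_extension[OF rep V dim4 P c cube small])
qed

theorem proposition5p2:
  fixes sc :: "complex \<Rightarrow> 'v::ab_group_add \<Rightarrow> 'v"
  shows
    "(\<forall>l1 l2 l3 l4 g2 \<rho>. is_Tuba_Wenzl_rep l1 l2 l3 l4 g2 \<rho> \<longrightarrow>
        admits_standard_extension (*s) \<rho>) \<and>
     (\<forall>\<rho>. vector_space sc \<and> vector_space.dim sc (UNIV :: 'v set) = 4 \<and>
        irreducible_rep B3 sc \<rho> \<longrightarrow> admits_standard_extension sc \<rho>)"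
proof (intro conjI allI impI)
  fix l1 l2 l3 l4 g2 \<rho>
  assume "is_Tuba_Wenzl_rep l1 l2 l3 l4 g2 \<rho>"
  then show "admits_standard_extension (*s) \<rho>"
    by (rule Tuba_Wenzl_admits_standard_extension)
next
  fix \<rho>
  assume asm: "vector_space sc \<and> vector_space.dim sc (UNIV :: 'v set) = 4 \<and> irreducible_rep B3 sc \<rho>"
  then interpret vector_space sc by blast
  have dim4: "dim (UNIV :: 'v set) = 4" and irr: "irreducible_rep B3 sc \<rho>"
    using asm by auto
  obtain Bs where Bs: "Bs \<subseteq> UNIV" "independent Bs" "UNIV \<subseteq> span Bs" "card Bs = dim (UNIV :: 'v set)"
    by (rule basis_exists)
  \<comment> \<open>An infinite basis would have \<open>card\<close> 0, so dimension 4 forces a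
    finite one.\<close>
  then have "finite Bs"
    using dim4 by (intro card_ge_0_finite) linarith
  then have V: "complex_fin_dim sc Bs"
    using Bs by unfold_locales auto
  let ?P = "\<lambda>v. \<rho> (braid_elem Sigma1) (\<rho> (braid_elem Sigma2) v)"
  obtain c where "c \<noteq> 0" "\<And>v. ?P (?P (?P v)) = sc c v"
    "\<And>z. dim (complex_fin_dim.eigenspace sc ?P z) \<le> 2"
    using irreducible_braid_rep_eigenspaces[OF irr V dim4, of ?P] by blast
  moreover have "Defs.representation B3 sc \<rho>"
    using irr by (simp add: irreducible_rep_def)
  ultimately show "admits_standard_extension sc \<rho>"
    by (intro braid_rep_admits_standard_extension[OF _ V dim4]) auto
qed

end
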